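(* Let $q$ be an odd prime power, let $\zeta$ be a symplectic polarity of $\mathrm{PG}(3,q)$ with associated symplectic graph $Sp(4,q)$, and let $S$ be a special spread of $\mathrm{PG}(3,q)$ with respect to $\zeta$. Partition the vertices of $Sp(4,q)$ into two parts $V_1$ and $V_2$ of equal size such that, for every subgraph $K_{q+1,q+1}$ associated with $S$, one of its two bipartition parts is contained in $V_1$ and the other is contained in $V_2$. Let $\Gamma'_{q,S}$ be the graph obtained from $Sp(4,q)$ by replacing the subgraphs induced by $V_1$ and by $V_2$ by their complements (keeping the edges between $V_1$ and $V_2$ unchanged). Then $\Gamma'_{q,S}$ is a divisible design graph with parameters $$(v,k,\lambda_1,\lambda_2,m,n)=\Big((q^2+1)(q+1),\ \tfrac{q^3+q^2+3q+1}{2},\ \tfrac{q^3-q^2+3q+1}{2},\ q^2+q,\ 2,\ \tfrac{(q^2+1)(q+1)}{2}\Big).$$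
   Context: A $k$-regular graph on $v$ vertices is a divisible design graph with parameters $(v,k,\lambda_1,\lambda_2,m,n)$ if its vertex set can be partitioned into $m$ classes of size $n$ such that any two distinct vertices from the same class have exactly $\lambda_1$ common neighbours and any two vertices from different classes have exactly $\lambda_2$ common neighbours. A symplectic polarity $\zeta$ of $\mathrm{PG}(3,q)$ is a polarity with $x\in x^\zeta$ for every point $x$. The graph $Sp(4,q)$ has the points of $\mathrm{PG}(3,q)$ as vertices, two distinct points $x,y$ being adjacent iff $y\in x^\zeta$ (i.e. $x$ and $y$ are orthogonal). A line $L$ is totally isotropic if $L^\zeta=L$. A spread is a set of lines of $\mathrm{PG}(3,q)$ partitioning its point set. For $q$ odd, a special spread is a spread $S$ consisting of lines that are not totally isotropic such that for every $\ell\in S$ there is a uniquely determined line $\ell'\in S$ such that any point of $\ell$ is orthogonal to any point of $\ell'$ (that is, $\ell'=\ell^\zeta$). For paired lines $\ell,\ell'\in S$, the set $\ell\cup\ell'$ induces in $Sp(4,q)$ a complete bipartite graph $K_{q+1,q+1}$ with parts $\ell$ and $\ell'$; these are the subgraphs $K_{q+1,q+1}$ associated with $S$, and their vertex sets partition the vertex set of $Sp(4,q)$. *)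

theory Defs
  imports
    "HOL-Analysis.Cartesian_Space"
    "HOL-Library.Disjoint_Sets"
    "Graph_Theory.Graph_Theory"
begin

section \<open>Divisible design graphs\<close>

definition common_nbrs :: "'a pair_pre_digraph \<Rightarrow> 'a \<Rightarrow> 'a \<Rightarrow> 'a set" where
  "common_nbrs G x y = {z. (x, z) \<in> parcs G \<and> (y, z) \<in> parcs G}"

text \<open>
  A finite simple graph is a symmetric loopless \<^typ>\<open>'a pair_pre_digraph\<close>, that is, a
  \<^const>\<open>pair_graph\<close>; the degree of a vertex is then its out-degree.
\<close>

definition divisible_design_graph ::
    "'a pair_pre_digraph \<Rightarrow> nat \<Rightarrow> nat \<Rightarrow> nat \<Rightarrow> nat \<Rightarrow> nat \<Rightarrow> nat \<Rightarrow> bool" where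
  "divisible_design_graph G v k l1 l2 m n \<longleftrightarrow>
     pair_graph G \<and>
     card (pverts G) = v \<and>
     (\<forall>x\<in>pverts G. out_degree (with_proj G) x = k) \<and>
     (\<exists>P. partition_on (pverts G) P \<and> card P = m \<and> (\<forall>C\<in>P. card C = n) \<and>
        (\<forall>C\<in>P. \<forall>x\<in>C. \<forall>y\<in>C. x \<noteq> y \<longrightarrow> card (common_nbrs G x y) = l1) \<and>
        (\<forall>C\<in>P. \<forall>D\<in>P. C \<noteq> D \<longrightarrow>
           (\<forall>x\<in>C. \<forall>y\<in>D. card (common_nbrs G x y) = l2)))"

definition complement_on_parts ::
    "'a pair_pre_digraph \<Rightarrow> 'a set \<Rightarrow> 'a set \<Rightarrow> 'a pair_pre_digraph" where
  "complement_on_parts G V1 V2 =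
     \<lparr>pverts = pverts G,
      parcs = {(x, y). x \<in> pverts G \<and> y \<in> pverts G \<and> x \<noteq> y \<and>
                 (if (x \<in> V1 \<and> y \<in> V1) \<or> (x \<in> V2 \<and> y \<in> V2)
                  then (x, y) \<notin> parcs G else (x, y) \<in> parcs G)}\<rparr>"


section \<open>Symplectic polarities of PG(3,q) and special spreads\<close>

text \<open>
  The subspaces of PG(3,q) are the linear subspaces of the four-dimensional vector space
  over the field with q elements; incidence is inclusion.  Points and lines have vector space
  dimension 1 and 2.
\<close>

definition pg_points :: "('a::field ^ 4) set set" where
  "pg_points = {P. vec.subspace P \<and> vec.dim P = 1}"

definition pg_lines :: "('a::field ^ 4) set set" where
  "pg_lines = {L. vec.subspace L \<and> vec.dim L = 2}"

definition points_on :: "('a::field ^ 4) set \<Rightarrow> ('a ^ 4) set set" where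
  "points_on L = {P \<in> pg_points. P \<subseteq> L}"

text \<open>Only the values on linear subspaces matter: elsewhere the map is arbitrary.\<close>

definition polarity :: "(('a::field ^ 4) set \<Rightarrow> ('a ^ 4) set) \<Rightarrow> bool" where
  "polarity \<zeta> \<longleftrightarrow>
     (\<forall>U. vec.subspace U \<longrightarrow> vec.subspace (\<zeta> U) \<and> \<zeta> (\<zeta> U) = U) \<and>
     (\<forall>U W. vec.subspace U \<and> vec.subspace W \<and> U \<subseteq> W \<longrightarrow> \<zeta> W \<subseteq> \<zeta> U)"

definition symplectic_polarity :: "(('a::field ^ 4) set \<Rightarrow> ('a ^ 4) set) \<Rightarrow> bool" where
  "symplectic_polarity \<zeta> \<longleftrightarrow> polarity \<zeta> \<and> (\<forall>x\<in>pg_points. x \<subseteq> \<zeta> x)"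

definition orthogonal_points ::
    "(('a::field ^ 4) set \<Rightarrow> ('a ^ 4) set) \<Rightarrow> ('a ^ 4) set \<Rightarrow> ('a ^ 4) set \<Rightarrow> bool" where
  "orthogonal_points \<zeta> x y \<longleftrightarrow> y \<subseteq> \<zeta> x"

definition symplectic_graph ::
    "(('a::field ^ 4) set \<Rightarrow> ('a ^ 4) set) \<Rightarrow> ('a ^ 4) set pair_pre_digraph" where
  "symplectic_graph \<zeta> =
     \<lparr>pverts = pg_points,
      parcs = {(x, y). x \<in> pg_points \<and> y \<in> pg_points \<and> x \<noteq> y \<and> orthogonal_points \<zeta> x y}\<rparr>"

definition totally_isotropic_line ::
    "(('a::field ^ 4) set \<Rightarrow> ('a ^ 4) set) \<Rightarrow> ('a ^ 4) set \<Rightarrow> bool" where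
  "totally_isotropic_line \<zeta> L \<longleftrightarrow> L \<in> pg_lines \<and> \<zeta> L = L"

definition spread :: "('a::field ^ 4) set set \<Rightarrow> bool" where
  "spread S \<longleftrightarrow> S \<subseteq> pg_lines \<and> (\<forall>P\<in>pg_points. \<exists>!L. L \<in> S \<and> P \<in> points_on L)"

definition orthogonal_lines ::
    "(('a::field ^ 4) set \<Rightarrow> ('a ^ 4) set) \<Rightarrow> ('a ^ 4) set \<Rightarrow> ('a ^ 4) set \<Rightarrow> bool" where
  "orthogonal_lines \<zeta> L M \<longleftrightarrow> (\<forall>x\<in>points_on L. \<forall>y\<in>points_on M. orthogonal_points \<zeta> x y)"

definition special_spread ::
    "(('a::field ^ 4) set \<Rightarrow> ('a ^ 4) set) \<Rightarrow> ('a ^ 4) set set \<Rightarrow> bool" where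
  "special_spread \<zeta> S \<longleftrightarrow>
     spread S \<and>
     (\<forall>L\<in>S. \<not> totally_isotropic_line \<zeta> L) \<and>
     (\<forall>L\<in>S. \<exists>!M. M \<in> S \<and> orthogonal_lines \<zeta> L M)"

text \<open>
  The pairs of bipartition parts of the complete bipartite subgraphs associated with a special
  spread, in either order: the point sets of two paired lines of the spread.
\<close>

definition associated_bipartitions ::
    "(('a::field ^ 4) set \<Rightarrow> ('a ^ 4) set) \<Rightarrow> ('a ^ 4) set set \<Rightarrow>
     (('a ^ 4) set set \<times> ('a ^ 4) set set) set" where
  "associated_bipartitions \<zeta> S =
     {(points_on L, points_on M) | L M. L \<in> S \<and> M \<in> S \<and> orthogonal_lines \<zeta> L M}"

end

theory Submission
  imports Defs
begin

text \<open>
  Let \<open>x\<close> lie on the spread line \<open>L\<close> and let \<open>M\<close> be the partner of \<open>L\<close>.  The plane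
  \<open>\<zeta> x\<close> contains \<open>M\<close>, hence no other spread line, since two lines of a plane meet; so it meets
  each remaining spread line in exactly one point.  As \<open>M\<close> lies in the part not containing \<open>x\<close>,
  the closed neighbourhood \<open>\<zeta> x\<close> has \<open>(q\<^sup>2 + 1) / 2\<close> points in the part of \<open>x\<close> and the
  remaining \<open>(q\<^sup>2 + 1) / 2 + q\<close> points in the other part.  Moreover
  \<open>\<zeta> x \<inter> \<zeta> y\<close> is a line for distinct points \<open>x, y\<close>.  These constants determine, by
  inclusion-exclusion, all degrees and common neighbour counts of the switched graph.
\<close>

section \<open>Complementing both parts of a bipartitioned graph\<close>

text \<open>Closed neighbourhoods are used because in the symplectic graph they are the point sets
  of the planes \<open>\<zeta> x\<close>, so no separate treatment of adjacent and nonadjacent pairs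
  arises.\<close>

definition closed_nbrs :: "'a pair_pre_digraph \<Rightarrow> 'a \<Rightarrow> 'a set" where
  "closed_nbrs G x = insert x {y. (x, y) \<in> parcs G}"

lemma closed_nbrs_subset:
  assumes "pair_graph G" "x \<in> pverts G"
  shows "closed_nbrs G x \<subseteq> pverts G"
proof -
  interpret pair_graph G by fact
  show ?thesis using assms(2) by (auto simp: closed_nbrs_def dest: in_arcsD2)
qed

text \<open>This symmetry transfers every count proved for a vertex of \<open>V1\<close> to the
  vertices of \<open>V2\<close>.\<close>

lemma complement_on_parts_commute:
  "complement_on_parts G V2 V1 = complement_on_parts G V1 V2"
  unfolding complement_on_parts_def by (simp add: disj_commute)

lemma pair_graph_complement_on_parts:
  assumes "pair_graph G"
  shows "pair_graph (complement_on_parts G V1 V2)"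
proof -
  interpret pair_graph G by fact
  have sym: "(x, y) \<in> parcs G \<longleftrightarrow> (y, x) \<in> parcs G" for x y
    using arcs_symmetric by blast
  have "finite (parcs (complement_on_parts G V1 V2))"
    by (rule finite_subset[of _ "pverts G \<times> pverts G"])
       (auto simp: complement_on_parts_def pair_finite_verts)
  then show ?thesis
    by unfold_locales
       (auto simp: complement_on_parts_def pair_finite_verts symmetric_def sym_def sym
             split: if_splits)
qed

text \<open>As \<open>x\<close> belongs to its own closed neighbourhood, removing that set from
  \<open>V1\<close> complements the adjacency and excludes the loop at once.\<close>

lemma complement_on_parts_nbrs:
  assumes "pair_graph G" "V1 \<union> V2 = pverts G" "V1 \<inter> V2 = {}" "x \<in> V1"
  shows "(x, z) \<in> parcs (complement_on_parts G V1 V2) \<longleftrightarrow>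
         z \<in> (V1 - closed_nbrs G x) \<union> (closed_nbrs G x \<inter> V2)"
  using assms unfolding complement_on_parts_def closed_nbrs_def by auto

text \<open>Inside \<open>V1\<close> the new common neighbours avoid both closed neighbourhoods;
  inside \<open>V2\<close> they lie in both. By inclusion-exclusion the two pieces of the
  intersection recombine, so only its total size enters. The additive form avoids truncated
  subtraction.\<close>

lemma card_common_nbrs_same_part:
  assumes "pair_graph G" "V1 \<union> V2 = pverts G" "V1 \<inter> V2 = {}" "x \<in> V1" "y \<in> V1"
  shows "card (common_nbrs (complement_on_parts G V1 V2) x y)
           + card (closed_nbrs G x \<inter> V1) + card (closed_nbrs G y \<inter> V1)
         = card V1 + card (closed_nbrs G x \<inter> closed_nbrs G y)"
proof -
  let ?N = "closed_nbrs G"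
  interpret pair_graph G by fact
  have fin: "finite V1" "finite V2"
    using pair_finite_verts assms(2) by (metis finite_Un)+
  have "common_nbrs (complement_on_parts G V1 V2) x y
          = (V1 - (?N x \<inter> V1 \<union> ?N y \<inter> V1)) \<union> (?N x \<inter> ?N y \<inter> V2)"
    unfolding common_nbrs_def complement_on_parts_nbrs[OF assms(1-4)]
      complement_on_parts_nbrs[OF assms(1-3,5)]
    using assms(3) by auto
  then have "card (common_nbrs (complement_on_parts G V1 V2) x y)
      = card (V1 - (?N x \<inter> V1 \<union> ?N y \<inter> V1)) + card (?N x \<inter> ?N y \<inter> V2)"
    using fin assms(3) by (auto intro!: card_Un_disjoint)
  moreover have "card (V1 - (?N x \<inter> V1 \<union> ?N y \<inter> V1)) + card (?N x \<inter> V1 \<union> ?N y \<inter> V1) = card V1"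
    using fin by (subst card_Un_disjoint[symmetric]) (auto intro: arg_cong[where f = card])
  moreover have "card (?N x \<inter> V1 \<union> ?N y \<inter> V1) + card (?N x \<inter> ?N y \<inter> V1)
      = card (?N x \<inter> V1) + card (?N y \<inter> V1)"
    using card_Un_Int[of "?N x \<inter> V1" "?N y \<inter> V1"] fin by (simp add: Int_ac)
  moreover have "card (?N x \<inter> ?N y \<inter> V1) + card (?N x \<inter> ?N y \<inter> V2) = card (?N x \<inter> ?N y)"
  proof -
    have "?N x \<inter> ?N y = (?N x \<inter> ?N y \<inter> V1) \<union> (?N x \<inter> ?N y \<inter> V2)"
      using closed_nbrs_subset[OF assms(1), of x] assms by auto
    then show ?thesis
      using fin assms(3) by (subst card_Un_disjoint[symmetric]) auto
  qed
  ultimately show ?thesis by linarith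
qed

text \<open>In either part exactly one of the two adjacencies is complemented, so the common
  neighbours there form a difference of closed neighbourhoods. The two subtracted pieces again add
  up to the whole intersection.\<close>

lemma card_common_nbrs_other_part:
  assumes "pair_graph G" "V1 \<union> V2 = pverts G" "V1 \<inter> V2 = {}" "x \<in> V1" "y \<in> V2"
  shows "card (common_nbrs (complement_on_parts G V1 V2) x y)
           + card (closed_nbrs G x \<inter> closed_nbrs G y)
         = card (closed_nbrs G x \<inter> V2) + card (closed_nbrs G y \<inter> V1)"
proof -
  let ?N = "closed_nbrs G"
  interpret pair_graph G by fact
  have fin: "finite V1" "finite V2"
    using pair_finite_verts assms(2) by (metis finite_Un)+
  have swap: "V2 \<union> V1 = pverts G" "V2 \<inter> V1 = {}" using assms by auto
  have "common_nbrs (complement_on_parts G V1 V2) x y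
          = (?N y \<inter> V1 - ?N x) \<union> (?N x \<inter> V2 - ?N y)"
    unfolding common_nbrs_def complement_on_parts_nbrs[OF assms(1-4)]
      complement_on_parts_nbrs[OF assms(1) swap assms(5), unfolded complement_on_parts_commute[of G V2]]
    using assms(3) by auto
  then have "card (common_nbrs (complement_on_parts G V1 V2) x y)
      = card (?N y \<inter> V1 - ?N x) + card (?N x \<inter> V2 - ?N y)"
    using fin assms(3) by (auto intro!: card_Un_disjoint)
  moreover have "card (?N y \<inter> V1 - ?N x) + card (?N x \<inter> ?N y \<inter> V1) = card (?N y \<inter> V1)"
    using fin by (subst card_Un_disjoint[symmetric]) (auto intro: arg_cong[where f = card])
  moreover have "card (?N x \<inter> V2 - ?N y) + card (?N x \<inter> ?N y \<inter> V2) = card (?N x \<inter> V2)"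
    using fin by (subst card_Un_disjoint[symmetric]) (auto intro: arg_cong[where f = card])
  moreover have "card (?N x \<inter> ?N y \<inter> V1) + card (?N x \<inter> ?N y \<inter> V2) = card (?N x \<inter> ?N y)"
  proof -
    have "?N x \<inter> ?N y = (?N x \<inter> ?N y \<inter> V1) \<union> (?N x \<inter> ?N y \<inter> V2)"
      using closed_nbrs_subset[OF assms(1), of x] assms by auto
    then show ?thesis
      using fin assms(3) by (subst card_Un_disjoint[symmetric]) auto
  qed
  ultimately show ?thesis by linarith
qed

lemma out_degree_complement_on_parts:
  assumes "pair_graph G" "V1 \<union> V2 = pverts G" "V1 \<inter> V2 = {}" "x \<in> V1"
  shows "out_degree (with_proj (complement_on_parts G V1 V2)) x + card (closed_nbrs G x \<inter> V1)
         = card V1 + card (closed_nbrs G x \<inter> V2)"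
proof -
  let ?N = "closed_nbrs G" and ?H = "complement_on_parts G V1 V2"
  interpret pair_graph G by fact
  have fin: "finite V1" "finite V2"
    using pair_finite_verts assms(2) by (metis finite_Un)+
  have "out_arcs (with_proj ?H) x = Pair x ` ((V1 - ?N x) \<union> (?N x \<inter> V2))"
    using complement_on_parts_nbrs[OF assms] by (auto simp: out_arcs_def with_proj_def)
  then have "out_degree (with_proj ?H) x = card ((V1 - ?N x) \<union> (?N x \<inter> V2))"
    unfolding out_degree_def by (simp add: card_image inj_on_def)
  also have "\<dots> = card (V1 - ?N x) + card (?N x \<inter> V2)"
    using fin assms(3) by (auto intro!: card_Un_disjoint)
  finally have "out_degree (with_proj ?H) x = card (V1 - ?N x) + card (?N x \<inter> V2)" .
  moreover have "card (V1 - ?N x) + card (?N x \<inter> V1) = card V1"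
    using fin by (subst card_Un_disjoint[symmetric]) (auto intro: arg_cong[where f = card])
  ultimately show ?thesis by linarith
qed

text \<open>Here \<open>a\<close> and \<open>b\<close> count closed neighbours in the own and in the
  opposite part, and \<open>c\<close> counts common closed neighbours. Equations \<open>k\<close>,
  \<open>l1\<close> and \<open>l2\<close> are the three preceding counts with these constants
  inserted.\<close>

lemma divisible_design_graph_complement_on_parts:
  assumes G: "pair_graph G" and V: "V1 \<union> V2 = pverts G" "V1 \<inter> V2 = {}"
    and n: "card V1 = n" "card V2 = n" "n > 0"
    and a: "\<And>x. x \<in> V1 \<Longrightarrow> card (closed_nbrs G x \<inter> V1) = a"
           "\<And>x. x \<in> V2 \<Longrightarrow> card (closed_nbrs G x \<inter> V2) = a"
    and b: "\<And>x. x \<in> V1 \<Longrightarrow> card (closed_nbrs G x \<inter> V2) = b"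
           "\<And>x. x \<in> V2 \<Longrightarrow> card (closed_nbrs G x \<inter> V1) = b"
    and c: "\<And>x y. x \<in> pverts G \<Longrightarrow> y \<in> pverts G \<Longrightarrow> x \<noteq> y \<Longrightarrow>
              card (closed_nbrs G x \<inter> closed_nbrs G y) = c"
    and k: "k + a = n + b" and l1: "l1 + 2 * a = n + c" and l2: "l2 + c = 2 * b"
  shows "divisible_design_graph (complement_on_parts G V1 V2) (2 * n) k l1 l2 2 n"
proof -
  let ?H = "complement_on_parts G V1 V2"
  interpret pair_graph G by fact
  have swap: "V2 \<union> V1 = pverts G" "V2 \<inter> V1 = {}" using V by auto
  have ne: "V1 \<noteq> {}" "V2 \<noteq> {}" using n by auto
  then have "V1 \<noteq> V2" using V(2) by auto
  have H [simp]: "pverts ?H = pverts G" by (simp add: complement_on_parts_def)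
  have fin: "finite V1" "finite V2"
    using pair_finite_verts V(1) by (metis finite_Un)+
  have same: "card (common_nbrs ?H x y) = l1" if "C \<in> {V1, V2}" "x \<in> C" "y \<in> C" "x \<noteq> y" for C x y
  proof -
    have "x \<in> pverts G" "y \<in> pverts G" using that V by auto
    note c' = c[OF this \<open>x \<noteq> y\<close>]
    from that(1) show ?thesis
    proof (elim insertE emptyE)
      assume "C = V1"
      then show ?thesis
        using card_common_nbrs_same_part[OF G V, of x y] that c' a(1)[of x] a(1)[of y] n l1 by auto
    next
      assume "C = V2"
      then show ?thesis
        using card_common_nbrs_same_part[OF G swap, of x y] that c' a(2)[of x] a(2)[of y] n l1
        by (auto simp: complement_on_parts_commute[of G V2])
    qed
  qed
  have other: "card (common_nbrs ?H x y) = l2" if "x \<in> V1" "y \<in> V2" for x y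
  proof -
    have "x \<in> pverts G" "y \<in> pverts G" "x \<noteq> y" using that V by auto
    from card_common_nbrs_other_part[OF G V that] c[OF this] b(1)[of x] b(2)[of y] that l2
    show ?thesis by auto
  qed
  have "common_nbrs ?H x y = common_nbrs ?H y x" for x y by (auto simp: common_nbrs_def)
  with other have other': "card (common_nbrs ?H x y) = l2" if "x \<in> V2" "y \<in> V1" for x y
    using that by metis
  have deg: "out_degree (with_proj ?H) x = k" if "x \<in> pverts G" for x
  proof -
    from that V consider "x \<in> V1" | "x \<in> V2" by auto
    then show ?thesis
    proof cases
      case 1
      then show ?thesis
        using out_degree_complement_on_parts[OF G V 1] a(1)[of x] b(1)[of x] n k by auto
    next
      case 2
      then show ?thesis
        using out_degree_complement_on_parts[OF G swap 2] a(2)[of x] b(2)[of x] n k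
        by (auto simp: complement_on_parts_commute[of G V2])
    qed
  qed
  have "card (pverts ?H) = 2 * n"
    using card_Un_disjoint[OF fin V(2)] V n by simp
  moreover have "partition_on (pverts ?H) {V1, V2}"
    using V ne by (auto simp: partition_on_def disjoint_def)
  moreover have "card {V1, V2} = 2" using \<open>V1 \<noteq> V2\<close> by simp
  moreover have "\<forall>C\<in>{V1, V2}. \<forall>D\<in>{V1, V2}. C \<noteq> D \<longrightarrow>
      (\<forall>x\<in>C. \<forall>y\<in>D. card (common_nbrs ?H x y) = l2)"
    using other other' by auto
  moreover have "\<forall>C\<in>{V1, V2}. \<forall>x\<in>C. \<forall>y\<in>C. x \<noteq> y \<longrightarrow> card (common_nbrs ?H x y) = l1"
    using same by blast
  moreover have "\<forall>C\<in>{V1, V2}. card C = n" using n by simp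
  moreover have "\<forall>x\<in>pverts ?H. out_degree (with_proj ?H) x = k" using deg by simp
  moreover have "pair_graph ?H" by (rule pair_graph_complement_on_parts[OF G])
  ultimately show ?thesis
    unfolding divisible_design_graph_def
    by (intro conjI exI[of _ "{V1, V2}"]) assumption+
qed


section \<open>Subspaces and points over a finite field\<close>

text \<open>Adjoining an independent vector \<open>b\<close> multiplies the size of the span by
  \<open>CARD('a)\<close>, since each vector of the larger span is uniquely
  \<open>v + k *s b\<close> with \<open>v\<close> in the smaller one.\<close>

lemma card_span_independent:
  fixes B :: "('a::{field, finite} ^ 'n) set"
  assumes "vec.independent B"
  shows "card (vec.span B) = CARD('a) ^ card B"
proof -
  have "finite B" by simp
  then show ?thesis using assms
  proof (induction B rule: finite_induct)
    case empty
    show ?case by simp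
  next
    case (insert b B)
    then have b: "b \<notin> vec.span B" "vec.independent B"
      by (simp_all add: vec.independent_insert)
    have "bij_betw (\<lambda>(k, v). v + k *s b) (UNIV \<times> vec.span B) (vec.span (insert b B))"
      unfolding bij_betw_def
    proof
      show "inj_on (\<lambda>(k, v). v + k *s b) (UNIV \<times> vec.span B)"
      proof (rule inj_onI, clarify)
        fix k v l w
        assume vw: "v \<in> vec.span B" "w \<in> vec.span B" and eq: "v + k *s b = w + l *s b"
        have d: "(k - l) *s b = w - v" using eq by (simp add: vec.scale_left_diff_distrib algebra_simps)
        \<comment> \<open>Distinct coefficients would allow division by \<open>k - l\<close>,
          placing \<open>b\<close> in the span of \<open>B\<close>.\<close>
        have "k = l"
        proof (rule ccontr)
          assume "k \<noteq> l"
          have "(k - l) *s b \<in> vec.span B" unfolding d using vw by (rule vec.span_diff[rotated])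
          then have "inverse (k - l) *s ((k - l) *s b) \<in> vec.span B" by (rule vec.span_scale)
          with \<open>k \<noteq> l\<close> b show False by simp
        qed
        with eq show "k = l \<and> v = w" by simp
      qed
      show "(\<lambda>(k, v). v + k *s b) ` (UNIV \<times> vec.span B) = vec.span (insert b B)"
      proof (intro equalityI subsetI)
        fix x assume "x \<in> (\<lambda>(k, v). v + k *s b) ` (UNIV \<times> vec.span B)"
        then obtain k v where "x = v + k *s b" "v \<in> vec.span B" by auto
        then have "x - k *s b \<in> vec.span B" by simp
        then show "x \<in> vec.span (insert b B)" by (auto simp: vec.span_breakdown_eq)
      next
        fix x assume "x \<in> vec.span (insert b B)"
        then obtain k where "x - k *s b \<in> vec.span B" by (auto simp: vec.span_breakdown_eq)
        then show "x \<in> (\<lambda>(k, v). v + k *s b) ` (UNIV \<times> vec.span B)"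
          by (intro image_eqI[of _ _ "(k, x - k *s b)"]) auto
      qed
    qed
    from bij_betw_same_card[OF this] insert b show ?case by (simp add: card_cartesian_product)
  qed
qed

lemma card_subspace:
  fixes U :: "('a::{field, finite} ^ 'n) set"
  assumes "vec.subspace U"
  shows "card U = CARD('a) ^ vec.dim U"
proof -
  obtain B where B: "B \<subseteq> U" "vec.independent B" "U \<subseteq> vec.span B" "card B = vec.dim U"
    by (rule vec.basis_exists)
  moreover have "vec.span B = U" using B assms by (simp add: vec.span_minimal subset_antisym)
  ultimately show ?thesis using card_span_independent[of B] by simp
qed

section \<open>Projective points and their number in a subspace\<close>

lemma pg_point_eq_span:
  assumes "P \<in> pg_points" "v \<in> P" "v \<noteq> 0"
  shows "P = vec.span {v}"
proof -
  have "vec.span {v} = P"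
    using assms by (intro vec.subspace_dim_equal) (auto simp: pg_points_def vec.span_minimal)
  then show ?thesis ..
qed

lemma span_in_pg_points:
  "v \<noteq> 0 \<Longrightarrow> vec.span {v} \<in> pg_points"
  by (simp add: pg_points_def)

lemma point_on_exists:
  assumes "vec.subspace U" "v \<in> U" "v \<noteq> 0"
  shows "\<exists>P\<in>points_on U. v \<in> P"
  using assms span_in_pg_points[of v]
  by (intro bexI[of _ "vec.span {v}"]) (auto simp: points_on_def vec.span_minimal vec.span_base)

text \<open>The nonzero vectors of \<open>U\<close> are partitioned by the points on
  \<open>U\<close>, each containing \<open>CARD('a) - 1\<close> of them; two points sharing a
  nonzero vector are both its span.\<close>

lemma card_points_on:
  fixes U :: "('a::{field, finite} ^ 4) set"
  assumes "vec.subspace U"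
  shows "card (points_on U) * (CARD('a) - 1) = CARD('a) ^ vec.dim U - 1"
proof -
  have zero: "0 \<in> P" if "P \<in> pg_points" for P :: "('a ^ 4) set"
    using that by (simp add: pg_points_def vec.subspace_0)
  have "U - {0} = (\<Union>P\<in>points_on U. P - {0})"
    using point_on_exists[OF assms] by (fastforce simp: points_on_def)
  also have "card \<dots> = (\<Sum>P\<in>points_on U. card (P - {0}))"
  proof (rule card_UN_disjoint)
    have "P = Q" if "P \<in> points_on U" "Q \<in> points_on U" "v \<in> P" "v \<in> Q" "v \<noteq> 0" for P Q v
      using that pg_point_eq_span[of P v] pg_point_eq_span[of Q v] by (simp add: points_on_def)
    then show "\<forall>P\<in>points_on U. \<forall>Q\<in>points_on U. P \<noteq> Q \<longrightarrow> (P - {0}) \<inter> (Q - {0}) = {}"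
      by blast
  qed auto
  also have "\<dots> = (\<Sum>P\<in>points_on U. CARD('a) - 1)"
    by (rule sum.cong)
       (auto simp: points_on_def zero card_subspace pg_points_def vec.subspace_0 card_Diff_singleton)
  finally show ?thesis
    using assms by (simp add: card_subspace vec.subspace_0 card_Diff_singleton)
qed

lemma
  fixes U :: "('a::{field, finite} ^ 4) set"
  assumes "vec.subspace U"
  shows card_points_on_point: "vec.dim U = 1 \<Longrightarrow> card (points_on U) = 1"
    and card_points_on_line: "vec.dim U = 2 \<Longrightarrow> card (points_on U) = CARD('a) + 1"
    and card_points_on_plane: "vec.dim U = 3 \<Longrightarrow> card (points_on U) = CARD('a)^2 + CARD('a) + 1"
    and card_points_on_space:
      "vec.dim U = 4 \<Longrightarrow> card (points_on U) = (CARD('a)^2 + 1) * (CARD('a) + 1)"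
proof -
  have "card {0, 1 :: 'a} \<le> CARD('a)" by (rule card_mono) auto
  \<comment> \<open>Writing the field size as \<open>r + 2\<close> makes the factor
    \<open>CARD('a) - 1\<close> visibly nonzero, so it can be cancelled, and removes the
    subtractions from the polynomial identities.\<close>
  then obtain r where r: "CARD('a) = Suc (Suc r)"
    by (metis add_2_eq_Suc card_2_iff le_Suc_ex zero_neq_one)
  have *: "card (points_on U) = m"
    if "m * (CARD('a) - 1) = CARD('a) ^ vec.dim U - 1" for m
    using card_points_on[OF assms] that r by (metis diff_Suc_1 mult_right_cancel nat.distinct(1))
  show "vec.dim U = 1 \<Longrightarrow> card (points_on U) = 1"
    by (intro *) simp
  show "vec.dim U = 2 \<Longrightarrow> card (points_on U) = CARD('a) + 1"
    by (intro *) (simp add: r power2_eq_square algebra_simps)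
  show "vec.dim U = 3 \<Longrightarrow> card (points_on U) = CARD('a)^2 + CARD('a) + 1"
    by (intro *) (simp add: r power3_eq_cube power2_eq_square algebra_simps)
  show "vec.dim U = 4 \<Longrightarrow> card (points_on U) = (CARD('a)^2 + 1) * (CARD('a) + 1)"
    by (intro *) (simp add: r power4_eq_xxxx power2_eq_square algebra_simps)
qed

text \<open>The dimension formula, with the sum of \<open>U\<close> and \<open>W\<close> bounded by
  \<open>X\<close>. It serves for two lines in a plane and for a line and a plane in the whole
  space.\<close>

lemma dim_inter_ge:
  fixes U W X :: "('a::field ^ 'n) set"
  assumes "vec.subspace U" "vec.subspace W" "vec.subspace X" "U \<subseteq> X" "W \<subseteq> X"
  shows "vec.dim U + vec.dim W \<le> vec.dim (U \<inter> W) + vec.dim X"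
proof -
  have "{x + y |x y. x \<in> U \<and> y \<in> W} \<subseteq> X"
    using assms by (auto intro: vec.subspace_add)
  then have "vec.dim {x + y |x y. x \<in> U \<and> y \<in> W} \<le> vec.dim X" by (rule vec.dim_subset)
  with vec.dim_sums_Int[OF assms(1,2)] show ?thesis by linarith
qed

lemma common_point_exists:
  assumes "vec.subspace U" "vec.subspace W" "vec.dim (U \<inter> W) > 0"
  shows "\<exists>P. P \<in> points_on U \<and> P \<in> points_on W"
proof -
  obtain v where "v \<in> U \<inter> W" "v \<noteq> 0"
    using assms(3) vec.dim_eq_0[of "U \<inter> W"] by fastforce
  with point_on_exists[OF vec.subspace_inter[OF assms(1,2)]] show ?thesis
    by (fastforce simp: points_on_def)
qed


section \<open>Polarities\<close>

lemma
  assumes "polarity \<zeta>"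
  shows polarity_subspace: "vec.subspace U \<Longrightarrow> vec.subspace (\<zeta> U)"
    and polarity_involution: "vec.subspace U \<Longrightarrow> \<zeta> (\<zeta> U) = U"
    and polarity_antimono: "vec.subspace U \<Longrightarrow> vec.subspace W \<Longrightarrow> U \<subseteq> W \<Longrightarrow> \<zeta> W \<subseteq> \<zeta> U"
  using assms unfolding polarity_def by auto

text \<open>Orthogonality is symmetric: apply \<open>\<zeta>\<close> to the given inclusion and
  cancel the double polar.\<close>

lemma polarity_subset_swap:
  assumes "polarity \<zeta>" "vec.subspace U" "vec.subspace W" "W \<subseteq> \<zeta> U"
  shows "U \<subseteq> \<zeta> W"
  using polarity_antimono[OF assms(1,3) polarity_subspace[OF assms(1,2)] assms(4)]
  by (simp add: polarity_involution[OF assms(1,2)])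

text \<open>An involution is injective, so strict inclusions stay strict when reversed, and a strict
  inclusion of subspaces lowers the dimension.\<close>

lemma polarity_dim_less:
  fixes \<zeta> :: "('a::field ^ 4) set \<Rightarrow> ('a ^ 4) set"
  assumes "polarity \<zeta>" "vec.subspace U" "vec.subspace W" "U \<subset> W"
  shows "vec.dim (\<zeta> W) < vec.dim (\<zeta> U)"
proof -
  have "\<zeta> W \<subseteq> \<zeta> U" using polarity_antimono[OF assms(1-3)] assms(4) by blast
  moreover have "\<zeta> W \<noteq> \<zeta> U" 
    using polarity_involution[OF assms(1,2)] polarity_involution[OF assms(1,3)] assms(4) by auto
  ultimately show ?thesis
    using vec.subspace_dim_equal[OF polarity_subspace[OF assms(1,3)] polarity_subspace[OF assms(1,2)]]
    by (meson not_le)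
qed

text \<open>A polarity is given only as an inclusion-reversing involution, without a bilinear form.
  The dimension of the polar is therefore bounded by comparing \<open>U\<close> with a subspace one
  dimension smaller, respectively larger.\<close>

lemma polarity_dim:
  fixes \<zeta> :: "('a::field ^ 4) set \<Rightarrow> ('a ^ 4) set"
  assumes pol: "polarity \<zeta>" and U: "vec.subspace U"
  shows "vec.dim U + vec.dim (\<zeta> U) = 4"
proof (rule antisym)
  have four: "vec.dim W \<le> 4" for W :: "('a ^ 4) set"
    using vec.dim_subset_UNIV[of W] by (simp add: vec.dimension_def card_cart_basis)
  show "vec.dim U + vec.dim (\<zeta> U) \<le> 4"
    using U
  proof (induction "vec.dim U" arbitrary: U)
    case 0
    then show ?case using four[of "\<zeta> U"] by linarith
  next
    case (Suc d)
    obtain T where T: "vec.subspace T" "T \<subseteq> vec.span U" "vec.dim T = d"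
      by (rule vec.choose_subspace_of_subspace[of d U]) (use Suc.hyps(2) in auto)
    then have "T \<subset> U" using Suc by (metis n_not_Suc_n psubsetI vec.span_eq_iff)
    from polarity_dim_less[OF pol T(1) Suc.prems this] Suc.hyps(1)[OF T(3)[symmetric] T(1)] T Suc.hyps(2)
    show ?case by linarith
  qed
  show "4 \<le> vec.dim U + vec.dim (\<zeta> U)"
    using U
  \<comment> \<open>Induction on the codimension: enlarging \<open>U\<close> by one vector strictly
    shrinks the polar, so the lower bound passes down from the larger space.\<close>
  proof (induction "4 - vec.dim U" arbitrary: U)
    case 0
    then show ?case by simp
  next
    case (Suc d)
    then have "U \<noteq> UNIV" by (auto simp: card_cart_basis)
    then obtain b where b: "b \<notin> U" by auto
    let ?W = "vec.span (insert b U)"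
    have W: "vec.subspace ?W" "vec.dim ?W = Suc (vec.dim U)"
      using b Suc.prems by (simp_all add: vec.dim_insert vec.span_eq_iff[THEN iffD2])
    have "U \<subset> ?W" using b vec.span_base[of b "insert b U"] vec.span_superset[of "insert b U"] by auto
    from polarity_dim_less[OF pol Suc.prems W(1) this] Suc.hyps(1)[OF _ W(1)] W Suc.hyps(2)
    show ?case by linarith
  qed
qed

text \<open>A polarity turns joins into meets. For the harder inclusion, \<open>U\<close> and
  \<open>W\<close> both lie in the polar of the intersection, hence so does their span, and the
  inclusion is then swapped back.\<close>

lemma polarity_inter:
  assumes pol: "polarity \<zeta>" and U: "vec.subspace U" and W: "vec.subspace W"
  shows "\<zeta> U \<inter> \<zeta> W = \<zeta> (vec.span (U \<union> W))"
proof
  let ?X = "vec.span (U \<union> W)" and ?Z = "\<zeta> U \<inter> \<zeta> W"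
  have "U \<subseteq> ?X" "W \<subseteq> ?X" using vec.span_superset[of "U \<union> W"] by auto
  then show "\<zeta> ?X \<subseteq> ?Z"
    using polarity_antimono[OF pol U vec.subspace_span] polarity_antimono[OF pol W vec.subspace_span]
    by simp
  have Z: "vec.subspace ?Z" using polarity_subspace[OF pol] U W by (simp add: vec.subspace_inter)
  have "U \<subseteq> \<zeta> ?Z" "W \<subseteq> \<zeta> ?Z" using polarity_subset_swap[OF pol _ Z] U W by auto
  then have "?X \<subseteq> \<zeta> ?Z" by (simp add: vec.span_minimal polarity_subspace[OF pol Z])
  then show "?Z \<subseteq> \<zeta> ?X" by (rule polarity_subset_swap[OF pol Z vec.subspace_span])
qed

text \<open>The intersection is the polar of the line joining \<open>x\<close> and \<open>y\<close>,
  of dimension 4 - 2.\<close>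

lemma dim_polar_inter_of_points:
  fixes x y :: "('a::field ^ 4) set"
  assumes pol: "polarity \<zeta>" and x: "x \<in> pg_points" and y: "y \<in> pg_points" and "x \<noteq> y"
  shows "vec.dim (\<zeta> x \<inter> \<zeta> y) = 2"
proof -
  have sub: "vec.subspace x" "vec.subspace y" and dims: "vec.dim x = 1" "vec.dim y = 1"
    using x y by (auto simp: pg_points_def)
  have "x \<inter> y \<subseteq> {0}" using pg_point_eq_span[OF x] pg_point_eq_span[OF y] \<open>x \<noteq> y\<close> by blast
  then have "vec.dim (x \<inter> y) = 0" by simp
  moreover have "vec.span (x \<union> y) = {u + v |u v. u \<in> x \<and> v \<in> y}"
    using sub by (simp add: vec.span_Un vec.span_eq_iff[THEN iffD2])
  ultimately have "vec.dim (vec.span (x \<union> y)) = 2"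
    using vec.dim_sums_Int[OF sub] dims by (simp del: vec.dim_eq_0)
  with polarity_dim[OF pol vec.subspace_span[of "x \<union> y"]] show ?thesis
    by (simp add: polarity_inter[OF pol sub])
qed

section \<open>The symplectic graph and its closed neighbourhoods\<close>

lemma pair_graph_symplectic_graph:
  fixes \<zeta> :: "('a::{field, finite} ^ 4) set \<Rightarrow> ('a ^ 4) set"
  assumes "polarity \<zeta>"
  shows "pair_graph (symplectic_graph \<zeta>)"
proof -
  let ?G = "symplectic_graph \<zeta>"
  have "(y, x) \<in> parcs ?G" if "(x, y) \<in> parcs ?G" for x y
    using that polarity_subset_swap[OF assms, of x y]
    by (auto simp: symplectic_graph_def orthogonal_points_def pg_points_def)
  then have "sym (parcs ?G)" by (rule symI)
  then have "symmetric ?G" by (simp add: symmetric_def)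
  then show ?thesis
    by unfold_locales (auto simp: symplectic_graph_def)
qed

text \<open>The symplectic condition \<open>x \<subseteq> \<zeta> x\<close> accounts for the vertex
  \<open>x\<close> itself.\<close>

lemma closed_nbrs_symplectic_graph:
  assumes "symplectic_polarity \<zeta>" "x \<in> pg_points"
  shows "closed_nbrs (symplectic_graph \<zeta>) x = points_on (\<zeta> x)"
  using assms
  by (auto simp: closed_nbrs_def symplectic_graph_def points_on_def orthogonal_points_def
      symplectic_polarity_def)


section \<open>Special spreads\<close>

text \<open>Both sides count the spread lines inside \<open>V1\<close>: each such line contributes
  one point to the plane \<open>\<zeta> x\<close> and \<open>CARD('a) + 1\<close> points to
  \<open>V1\<close>.\<close>

lemma card_polar_inter_part:
  fixes \<zeta> :: "('a::{field, finite} ^ 4) set \<Rightarrow> ('a ^ 4) set"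
  assumes pol: "polarity \<zeta>" and S: "special_spread \<zeta> S"
    and V: "V1 \<union> V2 = pg_points" "V1 \<inter> V2 = {}"
    and parts: "\<And>A B. (A, B) \<in> associated_bipartitions \<zeta> S \<Longrightarrow>
           (A \<subseteq> V1 \<and> B \<subseteq> V2) \<or> (A \<subseteq> V2 \<and> B \<subseteq> V1)"
    and x: "x \<in> V1"
  shows "card (points_on (\<zeta> x) \<inter> V1) * (CARD('a) + 1) = card V1"
proof -
  define T where "T = {L \<in> S. points_on L \<subseteq> V1}"
  have xP: "x \<in> pg_points" using x V by auto
  have sx: "vec.subspace (\<zeta> x)" and dx: "vec.dim (\<zeta> x) = 3"
    using xP polarity_subspace[OF pol, of x] polarity_dim[OF pol, of x] by (auto simp: pg_points_def)
  have line: "vec.subspace L" "vec.dim L = 2" if "L \<in> S" for L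
    using S that by (auto simp: special_spread_def spread_def pg_lines_def)
  have spread: "\<exists>!L. L \<in> S \<and> P \<in> points_on L" if "P \<in> pg_points" for P
    using S that by (auto simp: special_spread_def spread_def)
  have pts: "points_on L \<subseteq> pg_points" for L :: "('a ^ 4) set"
    by (auto simp: points_on_def)
  have disj: "points_on L \<inter> points_on M = {}" if "L \<in> S" "M \<in> S" "L \<noteq> M" for L M
    using spread pts that by blast
  have partner: "\<exists>M\<in>S. orthogonal_lines \<zeta> L M \<and>
      (points_on L \<subseteq> V1 \<and> points_on M \<subseteq> V2 \<or> points_on L \<subseteq> V2 \<and> points_on M \<subseteq> V1)"
    if "L \<in> S" for L
  proof -
    have "\<exists>!M. M \<in> S \<and> orthogonal_lines \<zeta> L M"
      using S that by (simp add: special_spread_def)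
    then obtain M where M: "M \<in> S" "orthogonal_lines \<zeta> L M" by blast
    then have "(points_on L, points_on M) \<in> associated_bipartitions \<zeta> S"
      using that by (auto simp: associated_bipartitions_def)
    from parts[OF this] M show ?thesis by blast
  qed
  have V1_eq: "V1 = (\<Union>L\<in>T. points_on L)"
  proof
    show "V1 \<subseteq> (\<Union>L\<in>T. points_on L)"
    proof
      fix P assume P: "P \<in> V1"
      then obtain L where L: "L \<in> S" "P \<in> points_on L" using spread V by blast
      \<comment> \<open>The points of a spread line lie all in \<open>V1\<close> or all in
        \<open>V2\<close>, and \<open>P\<close> decides which.\<close>
      then have "points_on L \<subseteq> V1" using partner[OF L(1)] P V by blast
      with L show "P \<in> (\<Union>L\<in>T. points_on L)" by (auto simp: T_def)
    qed
  qed (auto simp: T_def)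
  obtain L0 where L0: "L0 \<in> S" "x \<in> points_on L0" using spread[OF xP] by blast
  then obtain M where M: "M \<in> S" "orthogonal_lines \<zeta> L0 M" "points_on M \<subseteq> V2"
    using partner[OF L0(1)] x V by blast
  have "M \<subseteq> \<zeta> x"
  proof
    fix v assume v: "v \<in> M"
    show "v \<in> \<zeta> x"
    proof (cases "v = 0")
      case True
      then show ?thesis using sx by (simp add: vec.subspace_0)
    next
      case False
      then obtain P where "P \<in> points_on M" "v \<in> P" using point_on_exists line M v by blast
      then show ?thesis
        using M(2) L0(2) by (auto simp: orthogonal_lines_def orthogonal_points_def)
    qed
  qed
  \<comment> \<open>This covers also the line \<open>L0\<close> through \<open>x\<close>. A line of
    \<open>T\<close> inside the plane \<open>\<zeta> x\<close> would meet \<open>M\<close>, although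
    their points lie in different parts; the dimension formula still forces at least one point of
    the plane on it.\<close>
  have one: "card (points_on L \<inter> points_on (\<zeta> x)) = 1" if L: "L \<in> T" for L
  proof -
    have LS: "L \<in> S" and LV: "points_on L \<subseteq> V1" using L by (auto simp: T_def)
    note [simp] = line[OF LS] line[OF M(1)] sx dx
    have no: "\<not> (P \<in> points_on L \<and> P \<in> points_on M)" for P
      using LV M(3) V(2) by blast
    have "\<not> L \<subseteq> \<zeta> x"
    proof
      assume "L \<subseteq> \<zeta> x"
      then have "vec.dim (L \<inter> M) > 0"
        using dim_inter_ge[of L M "\<zeta> x"] \<open>M \<subseteq> \<zeta> x\<close> by simp
      then show False using common_point_exists[of L M] no by auto
    qed
    then have "vec.dim (L \<inter> \<zeta> x) < vec.dim L"
      by (intro vec.dim_psubset) (simp add: vec.span_eq_iff[THEN iffD2] vec.subspace_inter psubset_eq, blast)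
    moreover have "vec.dim L + vec.dim (\<zeta> x) \<le> vec.dim (L \<inter> \<zeta> x) + vec.dim (UNIV :: ('a ^ 4) set)"
      by (rule dim_inter_ge) auto
    ultimately have "vec.dim (L \<inter> \<zeta> x) = 1" by (simp add: card_cart_basis)
    moreover have "points_on L \<inter> points_on (\<zeta> x) = points_on (L \<inter> \<zeta> x)"
      by (auto simp: points_on_def)
    ultimately show ?thesis by (simp add: card_points_on_point vec.subspace_inter)
  qed
  have "card V1 = (\<Sum>L\<in>T. card (points_on L))"
    unfolding V1_eq by (rule card_UN_disjoint) (auto simp: T_def disj)
  also have "\<dots> = card T * (CARD('a) + 1)"
    using line by (simp add: T_def card_points_on_line)
  finally have "card V1 = card T * (CARD('a) + 1)" .
  moreover have "card (points_on (\<zeta> x) \<inter> V1) = card T"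
  proof -
    have "points_on (\<zeta> x) \<inter> V1 = (\<Union>L\<in>T. points_on L \<inter> points_on (\<zeta> x))"
      using V1_eq by auto
    also have "card \<dots> = (\<Sum>L\<in>T. card (points_on L \<inter> points_on (\<zeta> x)))"
    proof (rule card_UN_disjoint)
      show "\<forall>L\<in>T. \<forall>M\<in>T. L \<noteq> M \<longrightarrow>
          points_on L \<inter> points_on (\<zeta> x) \<inter> (points_on M \<inter> points_on (\<zeta> x)) = {}"
        using disj unfolding T_def by blast
    qed auto
    also have "\<dots> = card T" using one by simp
    finally show ?thesis .
  qed
  ultimately show ?thesis by simp
qed

section \<open>Evaluation of the parameters\<close>

theorem theorem2:
  fixes q :: nat
    and \<zeta> :: "('a::{field, finite} ^ 4) set \<Rightarrow> ('a ^ 4) set"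
    and S :: "('a ^ 4) set set"
    and V1 V2 :: "('a ^ 4) set set"
  assumes "CARD('a) = q" and "odd q"
    and "symplectic_polarity \<zeta>"
    and "special_spread \<zeta> S"
    and "V1 \<union> V2 = pverts (symplectic_graph \<zeta>)" and "V1 \<inter> V2 = {}" and "card V1 = card V2"
    and "\<And>A B. (A, B) \<in> associated_bipartitions \<zeta> S \<Longrightarrow>
           (A \<subseteq> V1 \<and> B \<subseteq> V2) \<or> (A \<subseteq> V2 \<and> B \<subseteq> V1)"
  shows "divisible_design_graph (complement_on_parts (symplectic_graph \<zeta>) V1 V2)
           ((q^2 + 1) * (q + 1))
           ((q^3 + q^2 + 3 * q + 1) div 2)
           ((q^3 - q^2 + 3 * q + 1) div 2)
           (q^2 + q)
           2
           (((q^2 + 1) * (q + 1)) div 2)"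
proof -
  let ?G = "symplectic_graph \<zeta>"
  have pol: "polarity \<zeta>" using assms(3) by (simp add: symplectic_polarity_def)
  have verts: "pverts ?G = pg_points" by (simp add: symplectic_graph_def)
  have V: "V1 \<union> V2 = pg_points" "V2 \<union> V1 = pg_points" "V2 \<inter> V1 = {}"
    using assms(5,6) verts by auto
  have parts': "(A \<subseteq> V2 \<and> B \<subseteq> V1) \<or> (A \<subseteq> V1 \<and> B \<subseteq> V2)"
    if "(A, B) \<in> associated_bipartitions \<zeta> S" for A B
    using assms(8)[OF that] by blast
  \<comment> \<open>\<open>h\<close> is half of \<open>q^2 + 1\<close>, the number of lines in a
    spread; the halving is exact because \<open>q\<close> is odd.\<close>
  define h where "h = (q^2 + 1) div 2"
  have h: "2 * h = q^2 + 1" using assms(2) by (simp add: h_def)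
  define n where "n = h * (q + 1)"
  have n2: "2 * n = (q^2 + 1) * (q + 1)" using h by (simp add: n_def mult.assoc[symmetric])
  have "pg_points = points_on (UNIV :: ('a ^ 4) set)" by (auto simp: points_on_def)
  then have "card (pg_points :: ('a ^ 4) set set) = 2 * n"
    using card_points_on_space[of "UNIV :: ('a ^ 4) set"] assms(1) n2
    by (simp add: card_cart_basis)
  moreover have "card (V1 \<union> V2) = card V1 + card V2" using assms(6) by (intro card_Un_disjoint) auto
  ultimately have n: "card V1 = n" "card V2 = n" using V assms(7) by auto
  have own: "card (closed_nbrs ?G x \<inter> V1) = h" if "x \<in> V1" for x
  proof -
    have "card (points_on (\<zeta> x) \<inter> V1) * (q + 1) = h * (q + 1)"
      using card_polar_inter_part[OF pol assms(4) V(1) assms(6,8) that] assms(1) n n_def by simp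
    then have "card (points_on (\<zeta> x) \<inter> V1) = h" by (simp only: mult_cancel2) simp
    moreover have "x \<in> pg_points" using that V(1) by blast
    ultimately show ?thesis by (simp add: closed_nbrs_symplectic_graph[OF assms(3)])
  qed
  have own': "card (closed_nbrs ?G x \<inter> V2) = h" if "x \<in> V2" for x
  proof -
    have "card (points_on (\<zeta> x) \<inter> V2) * (q + 1) = h * (q + 1)"
      using card_polar_inter_part[OF pol assms(4) V(2,3) parts' that] assms(1) n n_def by simp
    then have "card (points_on (\<zeta> x) \<inter> V2) = h" by (simp only: mult_cancel2) simp
    moreover have "x \<in> pg_points" using that V(1) by blast
    ultimately show ?thesis by (simp add: closed_nbrs_symplectic_graph[OF assms(3)])
  qed
  \<comment> \<open>The closed neighbourhood is a plane with \<open>q^2 + q + 1 = 2 * h + q\<close>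
    points; taking away the \<open>h\<close> points in the own part leaves \<open>h + q\<close> in
    the other.\<close>
  have total: "card (closed_nbrs ?G x \<inter> V1) + card (closed_nbrs ?G x \<inter> V2) = 2 * h + q"
    if "x \<in> pg_points" for x
  proof -
    have "vec.subspace (\<zeta> x)" "vec.dim (\<zeta> x) = 3"
      using that polarity_subspace[OF pol, of x] polarity_dim[OF pol, of x] by (auto simp: pg_points_def)
    then have total: "card (closed_nbrs ?G x) = 2 * h + q"
      using closed_nbrs_symplectic_graph[OF assms(3) that] card_points_on_plane[of "\<zeta> x"] assms(1) h
      by simp
    have "closed_nbrs ?G x = (closed_nbrs ?G x \<inter> V1) \<union> (closed_nbrs ?G x \<inter> V2)"
      using closed_nbrs_symplectic_graph[OF assms(3) that] V(1) by (auto simp: points_on_def)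
    then have "card (closed_nbrs ?G x)
        = card ((closed_nbrs ?G x \<inter> V1) \<union> (closed_nbrs ?G x \<inter> V2))"
      by (rule arg_cong)
    also have "\<dots> = card (closed_nbrs ?G x \<inter> V1) + card (closed_nbrs ?G x \<inter> V2)"
      using assms(6) by (intro card_Un_disjoint) auto
    finally show ?thesis using total by simp
  qed
  have opp: "card (closed_nbrs ?G x \<inter> V2) = h + q" if "x \<in> V1" for x
    using total[of x] own[OF that] that V(1) by auto
  have opp': "card (closed_nbrs ?G x \<inter> V1) = h + q" if "x \<in> V2" for x
    using total[of x] own'[OF that] that V(1) by auto
  \<comment> \<open>The polar planes of two distinct points meet in a line, whether or not the
    points are orthogonal.\<close>
  have common: "card (closed_nbrs ?G x \<inter> closed_nbrs ?G y) = q + 1"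
    if "x \<in> pg_points" "y \<in> pg_points" "x \<noteq> y" for x y
  proof -
    have "vec.subspace (\<zeta> x \<inter> \<zeta> y)"
      using that polarity_subspace[OF pol] by (simp add: pg_points_def vec.subspace_inter)
    moreover have "points_on (\<zeta> x) \<inter> points_on (\<zeta> y) = points_on (\<zeta> x \<inter> \<zeta> y)"
      by (auto simp: points_on_def)
    ultimately show ?thesis
      using closed_nbrs_symplectic_graph[OF assms(3)] that assms(1)
      by (simp add: card_points_on_line dim_polar_inter_of_points[OF pol])
  qed
  have "n > 0" using n2 by (cases "n = 0") auto
  \<comment> \<open>Guarantees that the natural-number subtraction in the parameter
    \<open>\<lambda>\<^sub>1\<close> does not truncate.\<close>
  have "q^2 \<le> q^3" using assms(2) by (intro power_increasing) (auto simp: Suc_le_eq odd_pos)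
  have twice: "2 * n = q^3 + q^2 + q + 1"
    using n2 by (simp add: power3_eq_cube power2_eq_square algebra_simps)
  \<comment> \<open>Each numerator is exhibited as twice a natural number, so that
    \<open>div 2\<close> is exact. The constants are \<open>a = h\<close>, \<open>b = h + q\<close>
    and \<open>c = q + 1\<close>.\<close>
  have "q^3 + q^2 + 3 * q + 1 = 2 * (n + q)" using twice by simp
  then have k: "(q^3 + q^2 + 3 * q + 1) div 2 + h = n + (h + q)" by simp
  have "q^3 - q^2 + 3 * q + 1 = 2 * (n + q + 1 - 2 * h)" "2 * h \<le> n + q + 1"
    using twice h \<open>q^2 \<le> q^3\<close> by linarith+
  then have l1: "(q^3 - q^2 + 3 * q + 1) div 2 + 2 * h = n + (q + 1)" by simp
  have l2: "q^2 + q + (q + 1) = 2 * (h + q)" using h by simp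
  have "divisible_design_graph (complement_on_parts ?G V1 V2) (2 * n)
      ((q^3 + q^2 + 3 * q + 1) div 2) ((q^3 - q^2 + 3 * q + 1) div 2) (q^2 + q) 2 n"
    by (rule divisible_design_graph_complement_on_parts[OF pair_graph_symplectic_graph[OF pol]
          assms(5,6) n \<open>n > 0\<close> own own' opp opp' common[folded verts] k l1 l2])
  then show ?thesis unfolding n2[symmetric] by simp
qed

end
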